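(* Let $n\in\mathbb Z_+$, $f\in\mathrm{Homeo}_+(\mathcal S)$ and $f_n\in\mathrm{Homeo}_+(\mathbb R/n\mathbb Z)$. Then $f\in\mathrm{Homeo}_{I_n}(\mathcal S)$ is induced by $f_n$ if and only if $f$ has a lift $F:\mathbb R\times\widehat{\mathbb Z}\to\mathbb R\times\widehat{\mathbb Z}$ of the form $$(x,k)\longmapsto (F_0(x)+r(k),\,k),$$ where $F_0:\mathbb R\to\mathbb R$ is a lift of $f_n$ to $\mathbb R$ and $r(k)\in\{0,\dots,n-1\}$ is determined by $r(k)=i$ if $k\in p_n^{-1}(i)$, with $p_n:\widehat{\mathbb Z}\to\mathbb Z/n\mathbb Z$ the canonical projection.
   Context: Universal one-dimensional solenoid: $\mathcal S=\varprojlim_n \mathbb R/n\mathbb Z$ (index set $\mathbb Z_+$ ordered by divisibility, bonding maps the canonical projections), a compact connected abelian topological group, with projections $\pi_n:\mathcal S\to\mathbb R/n\mathbb Z$. Let $\widehat{\mathbb Z}=\varprojlim_n\mathbb Z/n\mathbb Z$, with $\mathbb Z\subset\widehat{\mathbb Z}$ densely. Equivalently $\mathcal S$ is the orbit space of $\mathbb R\times\widehat{\mathbb Z}$ under the $\mathbb Z$-action $t\cdot(x,k)=(x+t,k-t)$, with projection $p:\mathbb R\times\widehat{\mathbb Z}\to\mathcal S$; here $\pi_n(p(x,k))=x+p_n(k)\bmod n$. A lift of $f:\mathcal S\to\mathcal S$ is a homeomorphism $F$ of $\mathbb R\times\widehat{\mathbb Z}$ with $p\circ F=f\circ p$. $\mathrm{Homeo}_+(\mathcal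 S)$ is the group of orientation-preserving (along leaves) homeomorphisms of $\mathcal S$ isotopic to the identity; $\mathrm{Homeo}_+(\mathbb R/n\mathbb Z)$ is the group of orientation-preserving homeomorphisms of the circle $\mathbb R/n\mathbb Z$. $f\in\mathrm{Homeo}_+(\mathcal S)$ is induced (of degree $n$) by $f_n\in\mathrm{Homeo}_+(\mathbb R/n\mathbb Z)$ if $\pi_n\circ f=f_n\circ\pi_n$; $\mathrm{Homeo}_{I_n}(\mathcal S)$ is the set of all such $f$.
   Formalization: The lift is taken of the form (x,k) ↦ (F_0(x+r(k)) − r(k), k) instead of (F_0(x)+r(k), k); the printed form agrees for n=1 but for n≥2 is not a lift of any self-map of S (e.g. f=id, f_n=id is a counterexample). *)

theory Defs
  imports "HOL-Analysis.Analysis"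
begin

section \<open>The circles R/nZ\<close>

definition circle_class :: "nat \<Rightarrow> real \<Rightarrow> real set" where
  "circle_class n x = {x + real n * of_int j | j::int. True}"

text \<open>R/nZ is the set of cosets with the quotient topology (see \<open>quotient_map_circle_class\<close>).\<close>

definition circle :: "nat \<Rightarrow> real set topology" where
  "circle n = topology (\<lambda>U. U \<subseteq> range (circle_class n) \<and> open (circle_class n -` U))"

text \<open>The canonical projection onto R/mZ, defined on cosets of nZ for m dividing n
  (see \<open>circle_proj_class\<close>).\<close>

definition circle_proj :: "nat \<Rightarrow> real set \<Rightarrow> real set" where
  "circle_proj m c = (\<Union>x\<in>c. circle_class m x)"

definition circle_lift :: "nat \<Rightarrow> (real set \<Rightarrow> real set) \<Rightarrow> (real \<Rightarrow> real) \<Rightarrow> bool" where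
  "circle_lift n g G \<longleftrightarrow>
     homeomorphic_map euclideanreal euclideanreal G \<and>
     (\<forall>x. circle_class n (G x) = g (circle_class n x))"

text \<open>Maps on R/nZ, on the solenoid and on its cover are total functions on the ambient types;
  only their restriction to the respective \<open>topspace\<close> matters.\<close>

definition Homeo_plus_circle :: "nat \<Rightarrow> (real set \<Rightarrow> real set) set" where
  "Homeo_plus_circle n =
     {g. homeomorphic_map (circle n) (circle n) g \<and> (\<exists>G. circle_lift n g G \<and> strict_mono G)}"


section \<open>The profinite integers and the solenoid\<close>

text \<open>Both are inverse limits over the positive integers ordered by divisibility, realised as
  subspaces of the product; Z/nZ is the discrete set of residues 0, ..., n-1.  Points are
  families \<open>z\<close> indexed by the positive integers (and \<open>undefined\<close> at index 0), and the canonical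
  projections \<open>p_n\<close> and \<open>\<pi>_n\<close> are evaluation at \<open>n\<close>.\<close>

definition Zhat :: "(nat \<Rightarrow> int) topology" where
  "Zhat = subtopology (product_topology (\<lambda>n. discrete_topology {0..<int n}) {0<..})
     {k. \<forall>m>0. \<forall>n>0. m dvd n \<longrightarrow> k m = k n mod int m}"

definition solenoid :: "(nat \<Rightarrow> real set) topology" where
  "solenoid = subtopology (product_topology circle {0<..})
     {z. \<forall>m>0. \<forall>n>0. m dvd n \<longrightarrow> z m = circle_proj m (z n)}"

abbreviation cover_space :: "(real \<times> (nat \<Rightarrow> int)) topology" where
  "cover_space \<equiv> prod_topology euclideanreal Zhat"

text \<open>The projection \<open>p\<close>, given by its coordinates \<open>\<pi>_n (p (x, k)) = x + p_n k mod n\<close>.\<close>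

definition cover_proj :: "real \<times> (nat \<Rightarrow> int) \<Rightarrow> nat \<Rightarrow> real set" where
  "cover_proj = (\<lambda>(x, k). \<lambda>n\<in>{0<..}. circle_class n (x + of_int (k n)))"

definition Zhat_diff :: "(nat \<Rightarrow> int) \<Rightarrow> int \<Rightarrow> nat \<Rightarrow> int" where
  "Zhat_diff k t = (\<lambda>n\<in>{0<..}. (k n - t) mod int n)"

definition solenoid_lift ::
  "((nat \<Rightarrow> real set) \<Rightarrow> nat \<Rightarrow> real set) \<Rightarrow>
   (real \<times> (nat \<Rightarrow> int) \<Rightarrow> real \<times> (nat \<Rightarrow> int)) \<Rightarrow> bool" where
  "solenoid_lift f F \<longleftrightarrow>
     homeomorphic_map cover_space cover_space F \<and>
     (\<forall>w\<in>topspace cover_space. cover_proj (F w) = f (cover_proj w))"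

text \<open>The leaves (path components) of the solenoid are the sets
  \<open>range (\<lambda>x. cover_proj (x, k))\<close>, each parametrised injectively by the real line; the leaf
  and the parametrisation determine \<open>k\<close> up to adding an integer, which translates the
  parameter, so the choice of \<open>l\<close> does not affect monotonicity of \<open>g\<close>.\<close>

definition leafwise_orientation_preserving ::
  "((nat \<Rightarrow> real set) \<Rightarrow> nat \<Rightarrow> real set) \<Rightarrow> bool" where
  "leafwise_orientation_preserving f \<longleftrightarrow>
     (\<forall>k\<in>topspace Zhat. \<exists>l\<in>topspace Zhat. \<exists>g::real \<Rightarrow> real.
        continuous_on UNIV g \<and> strict_mono g \<and>
        (\<forall>x. f (cover_proj (x, k)) = cover_proj (g x, l)))"

text \<open>A homotopy through homeomorphisms is an isotopy.\<close>

definition Homeo_plus_solenoid :: "((nat \<Rightarrow> real set) \<Rightarrow> nat \<Rightarrow> real set) set" where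
  "Homeo_plus_solenoid =
     {f. homeomorphic_map solenoid solenoid f \<and> leafwise_orientation_preserving f \<and>
         homotopic_with (homeomorphic_map solenoid solenoid) solenoid solenoid id f}"

definition induced_by ::
  "nat \<Rightarrow> ((nat \<Rightarrow> real set) \<Rightarrow> nat \<Rightarrow> real set) \<Rightarrow> (real set \<Rightarrow> real set) \<Rightarrow> bool" where
  "induced_by n f g \<longleftrightarrow>
     f \<in> Homeo_plus_solenoid \<and> g \<in> Homeo_plus_circle n \<and> (\<forall>z\<in>topspace solenoid. f z n = g (z n))"

definition Homeo_induced :: "nat \<Rightarrow> ((nat \<Rightarrow> real set) \<Rightarrow> nat \<Rightarrow> real set) set" where
  "Homeo_induced n = {f. \<exists>g. induced_by n f g}"


section \<open>Basic facts\<close>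

lemma circle_class_eq_iff:
  "circle_class n x = circle_class n y \<longleftrightarrow> (\<exists>j::int. y = x + real n * of_int j)"
proof
  assume "circle_class n x = circle_class n y"
  moreover have "y \<in> circle_class n y"
    unfolding circle_class_def by (auto intro!: exI[of _ 0])
  ultimately show "\<exists>j::int. y = x + real n * of_int j"
    unfolding circle_class_def by auto
next
  assume "\<exists>j::int. y = x + real n * of_int j"
  then obtain j :: int where j: "y = x + real n * of_int j" by blast
  show "circle_class n x = circle_class n y"
  proof (intro equalityI subsetI)
    fix z assume "z \<in> circle_class n x"
    then obtain i :: int where "z = x + real n * of_int i" unfolding circle_class_def by auto
    then have "z = y + real n * of_int (i - j)" using j by (simp add: algebra_simps)
    then show "z \<in> circle_class n y" unfolding circle_class_def by blast
  next
    fix z assume "z \<in> circle_class n y"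
    then obtain i :: int where "z = y + real n * of_int i" unfolding circle_class_def by auto
    then have "z = x + real n * of_int (i + j)" using j by (simp add: algebra_simps)
    then show "z \<in> circle_class n x" unfolding circle_class_def by blast
  qed
qed

lemma openin_circle:
  "openin (circle n) U \<longleftrightarrow> U \<subseteq> range (circle_class n) \<and> open (circle_class n -` U)"
proof -
  have "istopology (\<lambda>U. U \<subseteq> range (circle_class n) \<and> open (circle_class n -` U))"
    unfolding istopology_def by (auto simp: vimage_Union)
  then show ?thesis unfolding circle_def by (simp add: topology_inverse')
qed

lemma topspace_circle [simp]: "topspace (circle n) = range (circle_class n)"
proof -
  have "circle_class n -` range (circle_class n) = UNIV" by auto
  then have "openin (circle n) (range (circle_class n))" by (simp add: openin_circle)
  then show ?thesis
    by (metis openin_circle openin_subset openin_topspace subset_antisym)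
qed

lemma quotient_map_circle_class: "quotient_map euclideanreal (circle n) (circle_class n)"
  unfolding quotient_map_def by (auto simp: openin_circle vimage_def)

lemma circle_proj_class:
  assumes "m dvd n"
  shows "circle_proj m (circle_class n x) = circle_class m x"
proof -
  obtain q where q: "n = m * q" using assms by blast
  have *: "circle_class m y = circle_class m x" if y: "y \<in> circle_class n x" for y
  proof -
    obtain j :: int where "y = x + real n * of_int j"
      using y unfolding circle_class_def by blast
    then have "y = x + real m * of_int (int q * j)" by (simp add: q)
    then show ?thesis using circle_class_eq_iff by metis
  qed
  have "x \<in> circle_class n x" unfolding circle_class_def by (auto intro!: exI[of _ 0])
  then show ?thesis unfolding circle_proj_def using * by blast
qed

lemma topspace_Zhat:
  "topspace Zhat = {k \<in> ({0<..} \<rightarrow>\<^sub>E UNIV). (\<forall>n>0. k n \<in> {0..<int n}) \<and>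
     (\<forall>m>0. \<forall>n>0. m dvd n \<longrightarrow> k m = k n mod int m)}"
proof -
  have "topspace (product_topology (\<lambda>n. discrete_topology {0..<int n}) {0<..}) =
      (\<Pi>\<^sub>E n\<in>{0<..}. {0..<int n})"
    by simp
  also have "\<dots> = {k \<in> ({0<..} \<rightarrow>\<^sub>E UNIV). \<forall>n>0. k n \<in> {0..<int n}}"
    unfolding PiE_def Pi_def by blast
  finally show ?thesis unfolding Zhat_def topspace_subtopology by blast
qed

lemma topspace_solenoid:
  "z \<in> topspace solenoid \<longleftrightarrow> z \<in> (\<Pi>\<^sub>E n\<in>{0<..}. range (circle_class n)) \<and>
     (\<forall>m>0. \<forall>n>0. m dvd n \<longrightarrow> z m = circle_proj m (z n))"
  unfolding solenoid_def
  by (simp only: topspace_subtopology topspace_product_topology Int_iff mem_Collect_eq o_def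
      topspace_circle)

lemma cover_proj_in_solenoid:
  assumes "k \<in> topspace Zhat"
  shows "cover_proj (x, k) \<in> topspace solenoid"
proof -
  have "cover_proj (x, k) m = circle_proj m (cover_proj (x, k) n)"
    if that: "m > 0" "n > 0" "m dvd n" for m n
  proof -
    have "k m = k n mod int m" using assms that unfolding topspace_Zhat by blast
    then have "k n = k m + int m * (k n div int m)" by simp
    then have "real_of_int (k n) = of_int (k m) + real m * of_int (k n div int m)"
      by (metis of_int_add of_int_mult of_int_of_nat_eq)
    then have "circle_class m (x + of_int (k m)) = circle_class m (x + of_int (k n))"
      unfolding circle_class_eq_iff by (intro exI[of _ "k n div int m"]) simp
    then show ?thesis using that by (simp add: cover_proj_def circle_proj_class)
  qed
  moreover have "cover_proj (x, k) \<in> (\<Pi>\<^sub>E n\<in>{0<..}. range (circle_class n))"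
    by (simp add: cover_proj_def)
  ultimately show ?thesis unfolding topspace_solenoid by blast
qed

lemma cover_proj_surj:
  assumes z: "z \<in> topspace solenoid"
  shows "\<exists>x. \<exists>k\<in>topspace Zhat. cover_proj (x, k) = z"
proof -
  have zP: "z \<in> (\<Pi>\<^sub>E n\<in>{0<..}. range (circle_class n))"
    using z unfolding topspace_solenoid by blast
  have ran: "z n \<in> range (circle_class n)" if "n > 0" for n
    using PiE_mem[OF zP, of n] that by simp
  have ext: "z 0 = undefined"
    using PiE_arb[OF zP, of 0] by simp
  have compat: "z m = circle_proj m (z n)" if "m > 0" "n > 0" "m dvd n" for m n
    using z that unfolding topspace_solenoid by blast
  obtain x where x: "z 1 = circle_class 1 x" using ran[of 1] by auto
  have "\<exists>a. a \<in> {0..<int n} \<and> z n = circle_class n (x + of_int a)" if n: "n > 0" for n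
  proof -
    obtain y where y: "z n = circle_class n y" using ran[OF n] by auto
    have "z 1 = circle_class 1 y" using compat[of 1 n] n by (simp add: y circle_proj_class)
    then obtain b :: int where b: "y = x + of_int b" using x circle_class_eq_iff[of 1 x y] by auto
    have "real_of_int b = of_int (int n * (b div int n) + b mod int n)" by simp
    then have "y = x + of_int (b mod int n) + real n * of_int (b div int n)"
      unfolding of_int_add of_int_mult b by simp
    then have "circle_class n (x + of_int (b mod int n)) = circle_class n y"
      unfolding circle_class_eq_iff by blast
    then show ?thesis using n y by (intro exI[of _ "b mod int n"]) auto
  qed
  then obtain a where a: "\<And>n. n > 0 \<Longrightarrow> a n \<in> {0..<int n}"
    and za: "\<And>n. n > 0 \<Longrightarrow> z n = circle_class n (x + of_int (a n))" by metis
  have compat_a: "a m = a n mod int m" if mn: "m > 0" "n > 0" "m dvd n" for m n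
  proof -
    have "circle_class m (x + of_int (a m)) = circle_class m (x + of_int (a n))"
      using compat[OF mn] mn by (simp add: za circle_proj_class)
    then obtain j :: int where "x + of_int (a n) = x + of_int (a m) + real m * of_int j"
      unfolding circle_class_eq_iff by blast
    then have "real_of_int (a n) = of_int (a m + int m * j)" by simp
    then have "a n = a m + int m * j" by (simp only: of_int_eq_iff)
    then show ?thesis using a[OF mn(1)] by auto
  qed
  have "restrict a {0<..} m = restrict a {0<..} n mod int m"
    if "m > 0" "n > 0" "m dvd n" for m n using compat_a[OF that] that by simp
  moreover have "restrict a {0<..} n \<in> {0..<int n}" if "n > 0" for n
    using a that by simp
  moreover have "restrict a {0<..} \<in> {0<..} \<rightarrow>\<^sub>E UNIV" by simp
  ultimately have "restrict a {0<..} \<in> topspace Zhat" unfolding topspace_Zhat by blast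
  moreover have "cover_proj (x, restrict a {0<..}) = z"
    unfolding cover_proj_def using za ext by (auto simp: fun_eq_iff restrict_def)
  ultimately show ?thesis by blast
qed

text \<open>The fibres of \<open>p\<close> are the orbits of the action \<open>t \<cdot> (x, k) = (x + t, k - t)\<close> of Z.\<close>

lemma cover_proj_eq_iff:
  assumes k: "k \<in> topspace Zhat" and l: "l \<in> topspace Zhat"
  shows "cover_proj (x, k) = cover_proj (y, l) \<longleftrightarrow>
    (\<exists>t::int. y = x + of_int t \<and> l = Zhat_diff k t)"
proof
  assume eq: "cover_proj (x, k) = cover_proj (y, l)"
  have cls: "circle_class n (x + of_int (k n)) = circle_class n (y + of_int (l n))"
    if "n > 0" for n
    using fun_cong[OF eq, of n] that by (simp add: cover_proj_def)
  have rk: "k n \<in> {0..<int n}" "l n \<in> {0..<int n}" if "n > 0" for n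
    using k l that unfolding topspace_Zhat by blast+
  obtain t :: int where t: "y = x + of_int t"
  proof -
    have "k 1 = 0" "l 1 = 0" using rk[of 1] by auto
    then show ?thesis using cls[of 1] that unfolding circle_class_eq_iff by auto
  qed
  have "l n = (k n - t) mod int n" if n: "n > 0" for n
  proof -
    obtain j :: int where "y + of_int (l n) = x + of_int (k n) + real n * of_int j"
      using cls[OF n] unfolding circle_class_eq_iff by blast
    then have "real_of_int (l n) = of_int (k n - t + int n * j)" using t by simp
    then have "l n = k n - t + int n * j" by (simp only: of_int_eq_iff)
    then have "l n mod int n = (k n - t) mod int n" by simp
    then show ?thesis using rk(2)[OF n] by simp
  qed
  moreover have "l 0 = undefined"
  proof -
    have "l \<in> {0<..} \<rightarrow>\<^sub>E UNIV" using l unfolding topspace_Zhat by blast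
    then show ?thesis by (rule PiE_arb) simp
  qed
  ultimately have "l = Zhat_diff k t"
    by (auto simp: Zhat_diff_def fun_eq_iff restrict_def)
  then show "\<exists>t::int. y = x + of_int t \<and> l = Zhat_diff k t" using t by blast
next
  assume "\<exists>t::int. y = x + of_int t \<and> l = Zhat_diff k t"
  then obtain t :: int where t: "y = x + of_int t" "l = Zhat_diff k t" by blast
  have "circle_class n (x + of_int (k n)) = circle_class n (y + of_int (l n))"
    if n: "n > 0" for n
  proof -
    define q where "q = (k n - t) div int n"
    have "l n = (k n - t) mod int n" using n t(2) by (simp add: Zhat_diff_def)
    moreover have "k n - t = int n * q + (k n - t) mod int n" unfolding q_def by simp
    ultimately have "l n = k n - t + int n * (- q)" by (simp only: mult_minus_right)
    then have "real_of_int (l n) = of_int (k n - t + int n * (- q))" by (simp only:)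
    then have "y + of_int (l n) = x + of_int (k n) + real n * of_int (- q)"
      using t by simp
    then show ?thesis unfolding circle_class_eq_iff by blast
  qed
  then show "cover_proj (x, k) = cover_proj (y, l)"
    by (simp add: cover_proj_def restrict_def fun_eq_iff)
qed


section \<open>On the shape of lifts of induced homeomorphisms\<close>

lemma induced_by_id:
  assumes "n > 0"
  shows "induced_by n id id"
proof -
  have "circle_lift n id id" "strict_mono (id :: real \<Rightarrow> real)"
    unfolding circle_lift_def by (auto simp: strict_mono_def)
  then have "id \<in> Homeo_plus_circle n" unfolding Homeo_plus_circle_def by auto
  moreover have "leafwise_orientation_preserving id"
    unfolding leafwise_orientation_preserving_def
    by (auto intro!: bexI exI[of _ id] simp: strict_mono_def)
  then have "id \<in> Homeo_plus_solenoid"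
    unfolding Homeo_plus_solenoid_def by (auto simp: homeomorphic_imp_continuous_map)
  ultimately show ?thesis unfolding induced_by_def by auto
qed

lemma Zhat_diff_in_Zhat:
  assumes "k \<in> topspace Zhat"
  shows "Zhat_diff k t \<in> topspace Zhat"
proof -
  have compat: "(k m - t) mod int m = (k n - t) mod int n mod int m"
    if mn: "m > 0" "n > 0" "m dvd n" for m n
  proof -
    have "k m = k n mod int m" using assms mn unfolding topspace_Zhat by blast
    then have "(k m - t) mod int m = (k n - t) mod int m" by (simp add: mod_diff_left_eq)
    then show ?thesis using mn by (simp add: mod_mod_cancel)
  qed
  have "Zhat_diff k t m = Zhat_diff k t n mod int m"
    if "m > 0" "n > 0" "m dvd n" for m n
    using compat[OF that] that by (simp add: Zhat_diff_def)
  moreover have "Zhat_diff k t n \<in> {0..<int n}" if "n > 0" for n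
    using that by (simp add: Zhat_diff_def)
  moreover have "Zhat_diff k t \<in> {0<..} \<rightarrow>\<^sub>E UNIV" by (simp add: Zhat_diff_def)
  ultimately show ?thesis unfolding topspace_Zhat by blast
qed

text \<open>A lift of a homeomorphism induced by a map of degree \<open>n\<close> is
  \<open>(x, k) \<mapsto> (F0 (x + r k) - r k, k)\<close>, where \<open>r k = k n\<close>.  The simpler-looking formula
  \<open>(F0 x + r k, k)\<close> agrees with it for \<open>n = 1\<close>, but for \<open>n \<ge> 2\<close> it is not the lift of any
  self-map of the solenoid.\<close>

lemma no_lift_add_residue:
  fixes F0 :: "real \<Rightarrow> real"
  assumes n: "n \<ge> 2" and lift: "solenoid_lift f F"
  shows "\<not> (\<forall>x. \<forall>k\<in>topspace Zhat. F (x, k) = (F0 x + real_of_int (k n), k))"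
proof
  assume F: "\<forall>x. \<forall>k\<in>topspace Zhat. F (x, k) = (F0 x + real_of_int (k n), k)"
  have step: "F0 1 + of_int ((k n - 1) mod int n) = F0 0 + of_int (k n) + 1"
    if k: "k \<in> topspace Zhat" for k
  proof -
    let ?l = "Zhat_diff k 1"
    have l: "?l \<in> topspace Zhat" using k by (rule Zhat_diff_in_Zhat)
    have "cover_proj (0, k) = cover_proj (1, ?l)"
      unfolding cover_proj_eq_iff[OF k l] by (intro exI[of _ 1]) simp
    then have "cover_proj (F (0, k)) = cover_proj (F (1, ?l))"
      using lift k l unfolding solenoid_lift_def by (auto simp: topspace_prod_topology)
    then have "cover_proj (F0 0 + of_int (k n), k) = cover_proj (F0 1 + of_int (?l n), ?l)"
      using F k l by simp
    then obtain t :: int where t: "F0 1 + of_int (?l n) = F0 0 + of_int (k n) + of_int t"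
      and kt: "?l = Zhat_diff k t"
      unfolding cover_proj_eq_iff[OF k l] by blast
    define m where "m = nat \<bar>t - 1\<bar> + 1"
    have "(k m - 1) mod int m = (k m - t) mod int m"
      using fun_cong[OF kt, of m] by (simp add: Zhat_diff_def m_def)
    then have "int m dvd (k m - 1) - (k m - t)" by (simp only: mod_eq_dvd_iff)
    then have "int m dvd t - 1" by simp
    then have "t = 1" using zdvd_imp_le[of "int m" "\<bar>t - 1\<bar>"] unfolding m_def by force
    then show ?thesis using t n by (simp add: Zhat_diff_def)
  qed
  define e where "e a = (\<lambda>m\<in>{0<..}. a mod int m)" for a :: int
  have e: "e a \<in> topspace Zhat" for a
    unfolding topspace_Zhat e_def by (auto simp: mod_mod_cancel)
  have "e 0 n = 0" "e 1 n = 1" using n by (auto simp: e_def)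
  moreover have "(- 1) mod int n = int n - 1" using n by (simp add: zmod_minus1)
  ultimately have "F0 1 + of_int (int n - 1) = F0 0 + 1" "F0 1 = F0 0 + 2"
    using step[OF e, of 0] step[OF e, of 1] by auto
  then show False using n by simp
qed

end

theory Submission
  imports Defs
begin

text \<open>Lifting paths from the circles to the line shows that a map isotopic to the identity keeps
  every leaf, so \<open>f (p (x, k)) = p (g k x, k)\<close>.  If \<open>f\<close> is induced by \<open>f\<^sub>n\<close> and \<open>G\<close> lifts
  \<open>f\<^sub>n\<close>, then \<open>g k x = G (x + k n) - k n + n * j k\<close> with \<open>j k\<close> an integer independent of \<open>x\<close>.
  The function \<open>j\<close> is constant on orbits of the integers since \<open>G (x + n) = G x + n\<close>, and by
  continuity of \<open>f\<close> it is continuous modulo every \<open>m\<close>; as the integers are dense, \<open>j\<close> is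
  constant and is absorbed into the lift of \<open>f\<^sub>n\<close>.\<close>

section \<open>Lifting paths from the circle to the line\<close>

text \<open>Distinct integers are at distance at least 1, so the range is discrete. Below, this
  makes differences of two lifts constant.\<close>

lemma continuous_Ints_valued_constant:
  fixes h :: "'a::topological_space \<Rightarrow> real"
  assumes "connected S" "continuous_on S h" "\<And>x. x \<in> S \<Longrightarrow> h x \<in> \<int>" "x \<in> S" "y \<in> S"
  shows "h x = h y"
proof -
  have "h constant_on S"
  proof (rule continuous_discrete_range_constant[OF assms(1,2)])
    fix x assume "x \<in> S"
    then have "1 \<le> norm (h y - h x)" if "y \<in> S" "h y \<noteq> h x" for y
      using assms(3) that by (metis Ints_diff Ints_nonzero_abs_ge1 eq_iff_diff_eq_0 real_norm_def)
    then show "\<exists>e>0. \<forall>y. y \<in> S \<and> h y \<noteq> h x \<longrightarrow> e \<le> norm (h y - h x)"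
      by (intro exI[of _ 1]) auto
  qed
  then show ?thesis using assms(4,5) unfolding constant_on_def by metis
qed

text \<open>The map \<open>e\<close> identifies R/nZ with the complex unit circle. A nonvanishing
  path there has a continuous logarithm, as the interval is contractible, and its rescaled imaginary
  part is the lift up to a period.\<close>

lemma circle_path_lift:
  assumes n: "n > 0"
    and c: "continuous_map (top_of_set {0..1}) (circle n) c"
    and c0: "c 0 = circle_class n x"
  obtains h :: "real \<Rightarrow> real" where "continuous_on {0..1} h" "h 0 = x"
    "\<And>t. t \<in> {0..1} \<Longrightarrow> c t = circle_class n (h t)"
proof -
  define e where "e x = cis (2 * pi * x / real n)" for x
  have e_eq: "e x = e y \<longleftrightarrow> circle_class n x = circle_class n y" for x y
  proof -
    have "e x = e y \<longleftrightarrow> (\<exists>j::int. 2 * pi * y / n = 2 * pi * x / n + 2 * pi * j)"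
      unfolding e_def by (auto simp: complex_eq_iff sin_cos_eq_iff[symmetric])
    also have "\<dots> \<longleftrightarrow> (\<exists>j::int. y = x + real n * j)"
    proof -
      have "2 * pi * y / n = 2 * pi * x / n + 2 * pi * j \<longleftrightarrow> y = x + real n * j" for j :: int
      proof -
        have "2 * pi * x / n + 2 * pi * j = 2 * pi * (x + real n * j) / n"
          using n by (simp add: field_simps)
        then show ?thesis using n by simp
      qed
      then show ?thesis by simp
    qed
    finally show ?thesis unfolding circle_class_eq_iff .
  qed
  \<comment> \<open>By \<open>e_eq\<close> the chosen representative is immaterial: \<open>E\<close>
    is \<open>e\<close> factored through the quotient map, whence its continuity.\<close>
  define E where "E c = e (SOME x. c = circle_class n x)" for c
  have E: "E (circle_class n x) = e x" for x
    unfolding E_def e_eq by (rule sym, rule someI_ex) blast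
  have "continuous_on UNIV e" unfolding e_def by (intro continuous_intros) (use n in auto)
  then have "continuous_map euclideanreal euclidean (E \<circ> circle_class n)"
    by (simp add: E o_def)
  then have "continuous_map (circle n) euclidean E"
    by (rule continuous_compose_quotient_map[OF quotient_map_circle_class])
  then have "continuous_map (top_of_set {0..1}) euclidean (E \<circ> c)"
    by (rule continuous_map_compose[OF c])
  then have cont: "continuous_on {0..1} (E \<circ> c)" by simp
  have c_ran: "c t \<in> range (circle_class n)" if "t \<in> {0..1}" for t
    using continuous_map_image_subset_topspace[OF c] that by auto
  have norm1: "norm ((E \<circ> c) t) = 1" if "t \<in> {0..1}" for t
    using c_ran[OF that] by (auto simp: E e_def)
  then have nz: "(E \<circ> c) t \<noteq> 0" if "t \<in> {0..1}" for t
    using that by (metis norm_zero zero_neq_one)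
  have "contractible {0..1::real}" by (simp add: convex_imp_contractible)
  then obtain L where L: "continuous_on {0..1} L" "\<And>t. t \<in> {0..1} \<Longrightarrow> (E \<circ> c) t = exp (L t)"
    using continuous_logarithm_on_contractible[OF cont _ nz] by metis
  \<comment> \<open>On the unit circle \<open>exp (L t)\<close> is \<open>cis (Im (L t))\<close>;
    \<open>h t\<close> solves \<open>2 * pi * h t / n = Im (L t)\<close>.\<close>
  define h where "h t = n * (Im (L t) / (2 * pi))" for t
  have h: "c t = circle_class n (h t)" if t: "t \<in> {0..1}" for t
  proof -
    obtain y where y: "c t = circle_class n y" using c_ran[OF t] by auto
    have "exp (Re (L t)) = 1" using norm1[OF t] L(2)[OF t] by simp
    then have "exp (L t) = cis (Im (L t))" by (simp add: exp_eq_polar)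
    then have "e y = cis (Im (L t))" using L(2)[OF t] y by (simp add: E)
    also have "\<dots> = e (h t)" using n by (simp add: e_def h_def)
    finally show ?thesis using y e_eq by simp
  qed
  have conth: "continuous_on {0..1} h"
    unfolding h_def by (intro continuous_intros L(1)) auto
  \<comment> \<open>The lift so far may start at another point of the class of \<open>x\<close>; a
    multiple of \<open>n\<close> corrects this.\<close>
  have "circle_class n (h 0) = circle_class n x" using h[of 0] c0 by simp
  then obtain j :: int where j: "x = h 0 + real n * of_int j"
    unfolding circle_class_eq_iff by blast
  show ?thesis
  proof
    show "continuous_on {0..1} (\<lambda>t. h t + real n * of_int j)"
      by (intro continuous_intros conth)
    show "h 0 + real n * of_int j = x" using j by simp
    show "c t = circle_class n (h t + real n * of_int j)" if "t \<in> {0..1}" for t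
      using h[OF that] circle_class_eq_iff by metis
  qed
qed

section \<open>Coordinates of the solenoid and of the profinite integers\<close>

lemma continuous_map_solenoid_coord:
  assumes "m > 0"
  shows "continuous_map solenoid (circle m) (\<lambda>z. z m)"
  unfolding solenoid_def using assms
  by (intro continuous_map_from_subtopology continuous_map_product_projection) simp

lemma solenoid_coord_proj:
  assumes "z \<in> topspace solenoid" "m dvd n" "m > 0" "n > 0"
  shows "z m = circle_proj m (z n)"
  using assms unfolding topspace_solenoid by blast

lemma solenoid_coord_0:
  assumes "z \<in> topspace solenoid"
  shows "z 0 = undefined"
proof -
  have "z \<in> (\<Pi>\<^sub>E n\<in>{0<..}. range (circle_class n))"
    using assms unfolding topspace_solenoid by blast
  then show ?thesis by (rule PiE_arb) simp
qed

text \<open>The map factors through the discrete set of residues modulo \<open>m\<close>, on which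
  every map is continuous.\<close>

lemma continuous_map_Zhat_coord:
  assumes "m > 0" "\<And>a. h a \<in> topspace X"
  shows "continuous_map Zhat X (\<lambda>k. h (k m))"
proof -
  have "continuous_map Zhat (discrete_topology {0..<int m}) (\<lambda>k. k m)"
    unfolding Zhat_def using assms(1)
    by (intro continuous_map_from_subtopology
        continuous_map_product_projection[where X = "\<lambda>n. discrete_topology {0..<int n}"]) simp
  moreover have "continuous_map (discrete_topology {0..<int m}) X h"
    using assms(2) by simp
  ultimately show ?thesis using continuous_map_compose[unfolded o_def] by blast
qed

lemma Zhat_coord_1:
  assumes "k \<in> topspace Zhat"
  shows "k 1 = 0"
proof -
  have "k 1 \<in> {0..<int 1}" using assms zero_less_one unfolding topspace_Zhat by blast
  then show ?thesis by simp
qed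

lemma zero_in_Zhat: "(\<lambda>m\<in>{0<..}. 0) \<in> topspace Zhat"
  unfolding topspace_Zhat by auto

lemma Zhat_cong:
  assumes "k \<in> topspace Zhat" "m > 0" "n > 0" "m dvd n"
  shows "k n mod int m = k m"
proof -
  have "k m = k n mod int m" using assms unfolding topspace_Zhat by blast
  then show ?thesis by simp
qed

text \<open>This makes the continuity of \<open>f\<close> usable across leaves: for fixed
  \<open>x\<close> each coordinate depends on a single residue of \<open>k\<close>.\<close>

lemma continuous_map_cover_proj_fibre:
  "continuous_map Zhat solenoid (\<lambda>k. cover_proj (x, k))"
proof -
  have "continuous_map Zhat (circle m) (\<lambda>k. cover_proj (x, k) m)" if m: "m > 0" for m
    using continuous_map_Zhat_coord[OF m, of "\<lambda>a. circle_class m (x + of_int a)" "circle m"] m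
    by (simp add: cover_proj_def)
  then have "continuous_map Zhat (product_topology circle {0<..}) (\<lambda>k. cover_proj (x, k))"
    unfolding continuous_map_componentwise by (auto simp: cover_proj_def)
  moreover have "(\<lambda>k. cover_proj (x, k)) \<in> topspace Zhat \<rightarrow>
      {z. \<forall>m>0. \<forall>n>0. m dvd n \<longrightarrow> z m = circle_proj m (z n)}"
    using cover_proj_in_solenoid solenoid_coord_proj by blast
  ultimately show ?thesis
    unfolding solenoid_def by (rule continuous_map_into_subtopology)
qed

section \<open>The integer action and the leaves\<close>

lemma cover_proj_translate:
  assumes "k \<in> topspace Zhat"
  shows "cover_proj (x + of_int t, Zhat_diff k t) = cover_proj (x, k)"
  using cover_proj_eq_iff[OF assms Zhat_diff_in_Zhat[OF assms]] by metis

text \<open>The action of the integers is free: a modulus exceeding the distance between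
  \<open>s\<close> and \<open>t\<close> separates them.\<close>

lemma Zhat_diff_inject:
  assumes "Zhat_diff k s = Zhat_diff k t"
  shows "s = t"
proof -
  define m where "m = nat \<bar>s - t\<bar> + 1"
  have "(k m - s) mod int m = (k m - t) mod int m"
    using fun_cong[OF assms, of m] by (simp add: Zhat_diff_def m_def)
  then have "int m dvd (k m - s) - (k m - t)" by (simp only: mod_eq_dvd_iff)
  then have "int m dvd t - s" by simp
  then have "\<bar>t - s\<bar> = 0 \<or> int m \<le> \<bar>t - s\<bar>" using zdvd_imp_le[of "int m" "\<bar>t - s\<bar>"] by force
  then show ?thesis unfolding m_def by auto
qed

text \<open>Lift every coordinate \<open>m\<close> to a real path starting at
  \<open>x + k m\<close>. Compatibility of the coordinates ties all these lifts to the one for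
  \<open>m = 1\<close>, which becomes the leaf parameter.\<close>

lemma solenoid_path_in_leaf:
  fixes c :: "real \<Rightarrow> nat \<Rightarrow> real set"
  assumes c: "continuous_map (top_of_set {0..1}) solenoid c"
    and k: "k \<in> topspace Zhat"
    and c0: "c 0 = cover_proj (x, k)"
    and t: "t \<in> {0..1}"
  shows "\<exists>y. c t = cover_proj (y, k)"
proof -
  have cs: "c s \<in> topspace solenoid" if "s \<in> {0..1}" for s
    using continuous_map_image_subset_topspace[OF c] that by auto
  have "\<exists>h. continuous_on {0..1} h \<and> h 0 = x + of_int (k m) \<and>
      (\<forall>t\<in>{0..1}. c t m = circle_class m (h t))" if m: "m > 0" for m
  proof -
    have cm: "continuous_map (top_of_set {0..1}) (circle m) (\<lambda>t. c t m)"
      using continuous_map_compose[OF c continuous_map_solenoid_coord[OF m]] by (simp add: o_def)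
    have "c 0 m = circle_class m (x + of_int (k m))"
      using c0 m by (simp add: cover_proj_def)
    from circle_path_lift[OF m cm this] obtain h where "continuous_on {0..1} h" "h 0 = x + of_int (k m)"
      "\<And>t. t \<in> {0..1} \<Longrightarrow> c t m = circle_class m (h t)"
      by metis
    then show ?thesis by blast
  qed
  then obtain h where h: "\<And>m. m > 0 \<Longrightarrow> continuous_on {0..1} (h m)"
    "\<And>m. m > 0 \<Longrightarrow> h m 0 = x + of_int (k m)"
    "\<And>m t. m > 0 \<Longrightarrow> t \<in> {0..1} \<Longrightarrow> c t m = circle_class m (h m t)"
    by metis
  \<comment> \<open>The two lifts agree modulo 1, so their difference is a continuous integer-valued
    function; its value at time 0 is \<open>k m\<close>, since \<open>k 1 = 0\<close>.\<close>
  have eq: "h m t = h 1 t + of_int (k m)" if m: "m > 0" for m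
  proof -
    have Z: "h m s - h 1 s \<in> \<int>" if s: "s \<in> {0..1}" for s
    proof -
      have "c s 1 = circle_proj 1 (c s m)"
        using solenoid_coord_proj[OF cs[OF s]] m by simp
      then have "circle_class 1 (h 1 s) = circle_class 1 (h m s)"
        using h(3)[OF m s] h(3)[of 1, OF _ s] by (simp add: circle_proj_class)
      then show ?thesis unfolding circle_class_eq_iff by auto
    qed
    have "continuous_on {0..1} (\<lambda>s. h m s - h 1 s)"
      by (intro continuous_intros h m) simp
    from continuous_Ints_valued_constant[OF _ this Z, of t 0] t
    have "h m t - h 1 t = h m 0 - h 1 0" by simp
    then show ?thesis using h(2)[OF m] h(2)[of 1] Zhat_coord_1[OF k] by simp
  qed
  have "c t 0 = undefined"
    using cs[OF t] by (rule solenoid_coord_0)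
  moreover have "c t m = circle_class m (h 1 t + of_int (k m))" if "m > 0" for m
    using h(3)[OF that t] eq[OF that] by simp
  ultimately have "c t = cover_proj (h 1 t, k)"
    by (auto simp: fun_eq_iff cover_proj_def restrict_def)
  then show ?thesis ..
qed

text \<open>The isotopy from \<open>id\<close> moves one point of the leaf along a path, which stays
  in that leaf. As \<open>f\<close> sends the whole leaf into a single leaf, \<open>l\<close> lies
  in the orbit of \<open>k\<close> and translating the parameter replaces \<open>l\<close> by
  \<open>k\<close>.\<close>

lemma Homeo_plus_solenoid_leaf:
  assumes f: "f \<in> Homeo_plus_solenoid" and k: "k \<in> topspace Zhat"
  shows "\<exists>g. continuous_on UNIV g \<and> (\<forall>x. f (cover_proj (x, k)) = cover_proj (g x, k))"
proof -
  obtain l g where l: "l \<in> topspace Zhat" and g: "continuous_on UNIV g"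
    "\<And>x. f (cover_proj (x, k)) = cover_proj (g x, l)"
    using f k unfolding Homeo_plus_solenoid_def leafwise_orientation_preserving_def by blast
  obtain H where H: "continuous_map (prod_topology (top_of_set {0..1::real}) solenoid) solenoid H"
    "\<And>z. H (0, z) = z" "\<And>z. H (1, z) = f z"
    using f unfolding Homeo_plus_solenoid_def homotopic_with_def by auto
  let ?z = "cover_proj (0, k)"
  have "continuous_map (top_of_set {0..1}) (prod_topology (top_of_set {0..1::real}) solenoid)
      (\<lambda>t. (t, ?z))"
    using cover_proj_in_solenoid[OF k] by (intro continuous_map_pairedI) auto
  from continuous_map_compose[OF this H(1)]
  have "continuous_map (top_of_set {0..1}) solenoid (\<lambda>t. H (t, ?z))" by (simp add: o_def)
  from solenoid_path_in_leaf[OF this k, of 0 1] obtain y where "f ?z = cover_proj (y, k)"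
    using H by auto
  then have "cover_proj (g 0, l) = cover_proj (y, k)" using g by simp
  then obtain t where "k = Zhat_diff l t" using cover_proj_eq_iff[OF l k] by auto
  then have "f (cover_proj (x, k)) = cover_proj (g x + of_int t, k)" for x
    using g(2) cover_proj_translate[OF l] by simp
  moreover have "continuous_on UNIV (\<lambda>x. g x + of_int t)" by (intro continuous_intros g)
  ultimately show ?thesis by blast
qed

section \<open>Lifts of circle homeomorphisms commute with the period\<close>

text \<open>The increment over one period is \<open>n * j\<close>. Monotonicity gives
  \<open>j > 0\<close>, and injectivity of \<open>g\<close> excludes \<open>j > 1\<close>.\<close>

lemma circle_lift_add_period:
  fixes x :: real
  assumes n: "n > 0" and G: "circle_lift n g G" "strict_mono G"
    and inj: "inj_on g (range (circle_class n))"
  shows "G (x + n) = G x + n"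
proof -
  have cls: "circle_class n (G y) = g (circle_class n y)" for y
    using G unfolding circle_lift_def by blast
  have "circle_class n (x + n) = circle_class n x"
    unfolding circle_class_eq_iff by (intro exI[of _ "-1"]) simp
  then have "circle_class n (G x) = circle_class n (G (x + n))" using cls by simp
  then obtain j :: int where j: "G (x + n) = G x + real n * of_int j" unfolding circle_class_eq_iff by blast
  have "G x < G (x + n)" using G(2) n by (simp add: strict_mono_less)
  then have "j > 0" using j n by (simp add: zero_less_mult_iff)
  moreover have "\<not> j > 1"
  proof
    assume "j > 1"
    then have lt: "G x + n < G (x + n)" using j n by simp
    have "continuous_on {x..x + n} G"
      using G(1) unfolding circle_lift_def
      by (metis continuous_map_iff_continuous2 continuous_on_subset homeomorphic_imp_continuous_map
          subset_UNIV)
    \<comment> \<open>If \<open>j > 1\<close>, the value \<open>G x + n\<close> is already taken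
      strictly inside the period, at a point whose class differs from that of \<open>x\<close> but
      has the same image.\<close>
    then obtain y where y: "x \<le> y" "y \<le> x + n" "G y = G x + n"
      using IVT'[of G x "G x + n" "x + n"] lt n by auto
    have "circle_class n (G x) = circle_class n (G y)"
      unfolding circle_class_eq_iff y(3) by (intro exI[of _ 1]) simp
    then have "circle_class n x = circle_class n y"
      using inj cls by (simp add: inj_on_eq_iff)
    then obtain i :: int where i: "y = x + real n * of_int i" unfolding circle_class_eq_iff by blast
    have "G x < G y" using y n by simp
    then have "x < y" using G(2) by (simp add: strict_mono_less)
    then have "i > 0" using i n by (simp add: zero_less_mult_iff)
    moreover have "y < x + n" using lt y G(2) by (metis strict_mono_less)
    then have "real n * of_int i < real n * 1" using i by simp
    then have "i < 1" using n by (simp only: mult_less_cancel_left_pos of_nat_0_less_iff of_int_less_1_iff)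
    ultimately show False by simp
  qed
  ultimately have "j = 1" by simp
  then show ?thesis using j by simp
qed

lemma circle_lift_add_periods:
  fixes x :: real
  assumes n: "n > 0" and G: "circle_lift n g G" "strict_mono G"
    and inj: "inj_on g (range (circle_class n))"
  shows "G (x + real n * of_int q) = G x + real n * of_int q"
proof (induction q arbitrary: x rule: int_induct[where k = 0])
  case base
  then show ?case by simp
next
  case (step1 i)
  have "G (x + real n * of_int (i + 1)) = G ((x + real n * of_int i) + n)" by (simp add: algebra_simps)
  also have "\<dots> = G (x + real n * of_int i) + n" by (rule circle_lift_add_period[OF assms])
  finally show ?case using step1 by (simp add: algebra_simps)
next
  case (step2 i)
  have "G (x + real n * of_int i) = G ((x + real n * of_int (i - 1)) + n)" by (simp add: algebra_simps)
  also have "\<dots> = G (x + real n * of_int (i - 1)) + n" by (rule circle_lift_add_period[OF assms])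
  finally show ?case using step2 by (simp add: algebra_simps)
qed

section \<open>Shears of the cover\<close>

lemma continuous_map_cover_shear:
  assumes n: "n > 0" and G: "continuous_on UNIV G"
  shows "continuous_map cover_space cover_space
    (\<lambda>(x, k). (G (x + of_int (k n)) - of_int (k n), k))"
proof -
  have k: "continuous_map cover_space euclideanreal (\<lambda>w. of_int (snd w n))"
    using continuous_map_compose[OF continuous_map_snd continuous_map_Zhat_coord[OF n],
        of _ euclideanreal] by (simp add: o_def)
  have "continuous_map cover_space euclideanreal (G \<circ> (\<lambda>w. fst w + of_int (snd w n)))"
    using G by (intro continuous_map_compose[of _ euclideanreal] continuous_map_add
        continuous_map_fst k) simp
  then show ?thesis unfolding case_prod_unfold o_def
    by (intro continuous_map_pairedI continuous_map_diff k continuous_map_snd) auto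
qed

text \<open>For fixed \<open>k\<close> the map is \<open>G\<close> conjugated by a translation, so
  the same formula with the inverse of \<open>G\<close> inverts it.\<close>

lemma homeomorphic_map_cover_shear:
  assumes n: "n > 0" and G: "homeomorphic_map euclideanreal euclideanreal G"
  shows "homeomorphic_map cover_space cover_space
    (\<lambda>(x, k). (G (x + of_int (k n)) - of_int (k n), k))"
proof -
  obtain G' where "homeomorphic_maps euclideanreal euclideanreal G G'"
    using G homeomorphic_map_maps by blast
  then have "continuous_on UNIV G" "continuous_on UNIV G'"
    "\<And>x. G' (G x) = x" "\<And>x. G (G' x) = x"
    unfolding homeomorphic_maps_def by auto
  then have "homeomorphic_maps cover_space cover_space
      (\<lambda>(x, k). (G (x + of_int (k n)) - of_int (k n), k))
      (\<lambda>(x, k). (G' (x + of_int (k n)) - of_int (k n), k))"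
    unfolding homeomorphic_maps_def using continuous_map_cover_shear[OF n] by auto
  then show ?thesis using homeomorphic_map_maps by blast
qed

section \<open>Limits in the circle and density of the integers\<close>

lemma closedin_circle_singleton:
  assumes m: "m > 0"
  shows "closedin (circle m) {circle_class m x}"
proof -
  have "circle_class m -` (range (circle_class m) - {circle_class m x})
      = - ((\<lambda>y. (y - x) / real m) -` \<int>)"
  proof -
    have "circle_class m y = circle_class m x \<longleftrightarrow> (y - x) / real m \<in> \<int>" for y
    proof -
      have "circle_class m x = circle_class m y \<longleftrightarrow> (\<exists>j::int. (y - x) / real m = of_int j)"
        unfolding circle_class_eq_iff using m by (simp add: field_simps)
      then show ?thesis by (metis Ints_cases Ints_of_int)
    qed
    then show ?thesis by auto
  qed
  moreover have "closed ((\<lambda>y. (y - x) / real m) -` \<int>)"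
    by (intro closed_vimage closed_Ints continuous_intros) (use m in auto)
  ultimately show ?thesis unfolding closedin_def openin_circle by (simp add: open_Compl)
qed

text \<open>Points of the circle are closed, so the complement of the constant value would be a
  neighbourhood of any other limit.\<close>

lemma limitin_circle_const:
  assumes "m > 0" "limitin (circle m) (\<lambda>i::nat. circle_class m x) (circle_class m y) sequentially"
  shows "circle_class m x = circle_class m y"
proof (rule ccontr)
  assume "circle_class m x \<noteq> circle_class m y"
  moreover have "openin (circle m) (topspace (circle m) - {circle_class m x})"
    using closedin_circle_singleton[OF assms(1)] by (simp add: closedin_def)
  ultimately show False using assms(2) unfolding limitin_sequentially by force
qed

text \<open>Subtracting \<open>- a\<close> from zero embeds the integer \<open>a\<close> in
  \<open>Zhat\<close>. Here \<open>a = k (fact i)\<close>, and \<open>m\<close> divides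
  \<open>fact i\<close> once \<open>i \<ge> m\<close>.\<close>

lemma Zhat_fact_residue:
  assumes "k \<in> topspace Zhat" "m > 0" "i \<ge> m"
  shows "Zhat_diff (\<lambda>m\<in>{0<..}. 0) (- k (fact i)) m = k m"
  using Zhat_cong[OF assms(1,2), of "fact i"] assms
  by (simp add: Zhat_diff_def dvd_fact Suc_le_eq)

text \<open>Density of the integers, with an explicit sequence: each coordinate is eventually equal
  to that of \<open>k\<close>.\<close>

lemma limitin_Zhat_fact:
  assumes k: "k \<in> topspace Zhat"
  shows "limitin Zhat (\<lambda>i. Zhat_diff (\<lambda>m\<in>{0<..}. 0) (- k (fact i))) k sequentially"
proof -
  let ?a = "\<lambda>i. Zhat_diff (\<lambda>m\<in>{0<..}. 0) (- k (fact i))"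
  have a: "?a i \<in> topspace Zhat" for i
    by (rule Zhat_diff_in_Zhat[OF zero_in_Zhat])
  have "limitin (discrete_topology {0..<int m}) (\<lambda>i. ?a i m) (k m) sequentially"
    if m: "m > 0" for m
  proof (rule limitin_eventually)
    show "k m \<in> topspace (discrete_topology {0..<int m})"
      using k m unfolding topspace_Zhat topspace_discrete_topology by blast
    show "\<forall>\<^sub>F i in sequentially. ?a i m = k m"
      using Zhat_fact_residue[OF k m] by (rule eventually_sequentiallyI)
  qed
  moreover have "k \<in> extensional {0<..}" using k unfolding topspace_Zhat PiE_def by blast
  ultimately show ?thesis
    using a k unfolding Zhat_def limitin_subtopology limitin_componentwise topspace_subtopology
    by (intro conjI always_eventually allI ballI) blast+
qed

section \<open>Lifts of induced homeomorphisms\<close>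

text \<open>A lift that keeps \<open>k\<close> must commute with the integer action. Conjugating
  \<open>F0\<close> by translation by the residue \<open>k n\<close> ensures this, since
  \<open>F0\<close> commutes with translation by \<open>n\<close>; for \<open>n \<ge> 2\<close>
  merely adding the residue fails, by \<open>no_lift_add_residue\<close>.\<close>

theorem theorem4p5:
  fixes n :: nat
    and f :: "(nat \<Rightarrow> real set) \<Rightarrow> nat \<Rightarrow> real set"
    and f\<^sub>n :: "real set \<Rightarrow> real set"
  assumes "n > 0"
    and "f \<in> Homeo_plus_solenoid"
    and "f\<^sub>n \<in> Homeo_plus_circle n"
  shows "(f \<in> Homeo_induced n \<and> induced_by n f f\<^sub>n) \<longleftrightarrow>
    (\<exists>F F0. solenoid_lift f F \<and> circle_lift n f\<^sub>n F0 \<and>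
       (\<forall>x. \<forall>k\<in>topspace Zhat.
          F (x, k) = (F0 (x + real_of_int (k n)) - real_of_int (k n), k)))"
proof
  assume "f \<in> Homeo_induced n \<and> induced_by n f f\<^sub>n"
  then have ind: "f z n = f\<^sub>n (z n)" if "z \<in> topspace solenoid" for z
    using that unfolding induced_by_def by blast
  obtain G where G: "circle_lift n f\<^sub>n G" "strict_mono G"
    using assms(3) unfolding Homeo_plus_circle_def by blast
  have "inj_on f\<^sub>n (range (circle_class n))"
    using assms(3) homeomorphic_imp_injective_map unfolding Homeo_plus_circle_def by fastforce
  note G_add = circle_lift_add_periods[OF \<open>n > 0\<close> G this]
  have G_homeo: "homeomorphic_map euclideanreal euclideanreal G"
    and G_class: "circle_class n (G x) = f\<^sub>n (circle_class n x)" for x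
    using G unfolding circle_lift_def by blast+
  then have G_cont: "continuous_on UNIV G"
    using homeomorphic_imp_continuous_map by fastforce
  obtain g where g_cont: "\<And>k. k \<in> topspace Zhat \<Longrightarrow> continuous_on UNIV (g k)"
    and g: "\<And>k x. k \<in> topspace Zhat \<Longrightarrow> f (cover_proj (x, k)) = cover_proj (g k x, k)"
    using Homeo_plus_solenoid_leaf[OF assms(2)] by metis

  have "\<exists>j::int. \<forall>x. g k x + of_int (k n) = G (x + of_int (k n)) + real n * of_int j"
    if k: "k \<in> topspace Zhat" for k
  proof -
    \<comment> \<open>Both terms of the difference represent \<open>f\<^sub>n\<close> of the class
      of \<open>x + k n\<close>, so \<open>h\<close> is integer-valued, and constant by continuity
      in \<open>x\<close>.\<close>
    define h where "h x = (g k x + of_int (k n) - G (x + of_int (k n))) / n" for x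
    have Z: "h x \<in> \<int>" for x
    proof -
      have "circle_class n (G (x + of_int (k n))) = circle_class n (g k x + of_int (k n))"
        using ind[OF cover_proj_in_solenoid[OF k], of x] g[OF k] \<open>n > 0\<close>
        by (simp add: cover_proj_def G_class)
      then obtain j :: int where "g k x + of_int (k n) = G (x + of_int (k n)) + real n * of_int j"
        unfolding circle_class_eq_iff by blast
      then show ?thesis using \<open>n > 0\<close> by (simp add: h_def)
    qed
    have "continuous_on UNIV h" unfolding h_def
      by (intro continuous_intros g_cont[OF k] continuous_on_compose2[OF G_cont])
        (use \<open>n > 0\<close> in auto)
    then have "h x = h 0" for x using continuous_Ints_valued_constant[of UNIV h x 0] Z by simp
    moreover obtain j where "h 0 = of_int j" using Z Ints_cases by blast
    ultimately have "h x = of_int j" for x by simp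
    then show ?thesis using \<open>n > 0\<close> by (intro exI[of _ j]) (simp add: h_def field_simps)
  qed
  then obtain j :: "(nat \<Rightarrow> int) \<Rightarrow> int" where
    j: "\<And>k x. k \<in> topspace Zhat \<Longrightarrow>
      g k x = G (x + of_int (k n)) + real n * of_int (j k) - of_int (k n)"
    by (metis add_diff_cancel_right')

  have j_orbit: "j (Zhat_diff k t) = j k" if k: "k \<in> topspace Zhat" for k t
  proof -
    let ?l = "Zhat_diff k t"
    have l: "?l \<in> topspace Zhat" using k by (rule Zhat_diff_in_Zhat)
    \<comment> \<open>The points \<open>(0, k)\<close> and \<open>(t, k - t)\<close> have the same
      projection. Comparing their images, freeness of the action forces the shift \<open>s\<close>
      to be \<open>t\<close>.\<close>
    have "cover_proj (g k 0, k) = cover_proj (g ?l (of_int t), ?l)"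
      using g[OF k, of 0] g[OF l, of "of_int t"] cover_proj_translate[OF k, of 0 t] by simp
    then obtain s where s: "g ?l (of_int t) = g k 0 + of_int s" "?l = Zhat_diff k s"
      using cover_proj_eq_iff[OF k l] by blast
    then have gt: "g ?l (of_int t) = g k 0 + of_int t" using Zhat_diff_inject by metis
    \<comment> \<open>\<open>q\<close> counts the periods dropped when \<open>k n - t\<close> is
      reduced modulo \<open>n\<close>; \<open>G_add\<close> compensates for them.\<close>
    define q where "q = (k n - t) div int n"
    have "?l n = (k n - t) mod int n" using \<open>n > 0\<close> by (simp add: Zhat_diff_def)
    then have "?l n = k n - t - int n * q" unfolding q_def by (simp add: minus_mult_div_eq_mod)
    then have ln: "real_of_int (?l n) = of_int (k n) - of_int t - real n * of_int q" by simp
    have "G (of_int (k n)) = G (of_int t + of_int (?l n)) + real n * of_int q"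
      using G_add[of "of_int t + of_int (?l n)" q] ln by simp
    then show ?thesis using gt j[OF k, of 0] j[OF l, of "of_int t"] ln \<open>n > 0\<close> by simp
  qed

  define z where "z = (\<lambda>m::nat\<in>{0<..}. 0::int)"
  have z: "z \<in> topspace Zhat" unfolding z_def by (rule zero_in_Zhat)
  have j_const: "j k = j z" if k: "k \<in> topspace Zhat" for k
  proof -
    \<comment> \<open>\<open>j\<close> enters \<open>g\<close> with the factor \<open>n\<close>, so
      coordinate \<open>n * m\<close> of the solenoid detects \<open>j\<close> modulo
      \<open>m\<close>.\<close>
    have dvd: "int m dvd j z - j k" if m: "m > 0" for m
    proof -
      let ?M = "n * m"
      have M: "?M > 0" "n \<le> ?M" using m \<open>n > 0\<close> by auto
      define a where "a i = Zhat_diff z (- k (fact i))" for i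
      have a: "a i \<in> topspace Zhat" for i unfolding a_def using z by (rule Zhat_diff_in_Zhat)
      have "continuous_map Zhat solenoid (\<lambda>k. cover_proj (0, k))"
        by (rule continuous_map_cover_proj_fibre)
      moreover have "continuous_map solenoid solenoid f"
        using assms(2) homeomorphic_imp_continuous_map unfolding Homeo_plus_solenoid_def by blast
      ultimately have "continuous_map Zhat (circle ?M)
          ((\<lambda>z. z ?M) \<circ> (f \<circ> (\<lambda>k. cover_proj (0, k))))"
        by (intro continuous_map_compose[OF _ continuous_map_solenoid_coord[OF M(1)]]
            continuous_map_compose)
      from continuous_map_limit[OF this limitin_Zhat_fact[OF k]]
      have "limitin (circle ?M) (\<lambda>i. f (cover_proj (0, a i)) ?M) (f (cover_proj (0, k)) ?M)
          sequentially"
        by (simp add: comp_def a_def z_def)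
      then have "limitin (circle ?M) (\<lambda>i. circle_class ?M (g (a i) 0 + of_int (a i ?M)))
          (circle_class ?M (g k 0 + of_int (k ?M))) sequentially"
        unfolding g[OF a] g[OF k] using M by (simp add: cover_proj_def)
      \<comment> \<open>From index \<open>n * m\<close> on, the residues of \<open>a i\<close>
        modulo \<open>n * m\<close> and \<open>n\<close> are those of \<open>k\<close>. Since
        \<open>a i\<close> lies in the orbit of \<open>z\<close>, the shifted sequence is
        constant.\<close>
      then have "limitin (circle ?M)
          (\<lambda>i. circle_class ?M (g (a (i + ?M)) 0 + of_int (a (i + ?M) ?M)))
          (circle_class ?M (g k 0 + of_int (k ?M))) sequentially"
        by (rule limitin_sequentially_offset)
      moreover have "g (a (i + ?M)) 0 + of_int (a (i + ?M) ?M)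
          = G (of_int (k n)) + real n * of_int (j z) - of_int (k n) + of_int (k ?M)" for i
      proof -
        have "a (i + ?M) ?M = k ?M" "a (i + ?M) n = k n"
          unfolding a_def z_def using M \<open>n > 0\<close>
          by (simp_all only: Zhat_fact_residue[OF k] le_add2 trans_le_add2)
        moreover have "j (a (i + ?M)) = j z" unfolding a_def using j_orbit[OF z] .
        ultimately show ?thesis using j[OF a, of "i + ?M" 0] by simp
      qed
      ultimately have "circle_class ?M
            (G (of_int (k n)) + real n * of_int (j z) - of_int (k n) + of_int (k ?M))
          = circle_class ?M (g k 0 + of_int (k ?M))"
        using limitin_circle_const[OF M(1)] by simp
      then obtain i :: int where "g k 0 + of_int (k ?M)
          = G (of_int (k n)) + real n * of_int (j z) - of_int (k n) + of_int (k ?M) + real ?M * of_int i"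
        using circle_class_eq_iff by blast
      then have "real n * of_int (j k) = real n * of_int (j z + int m * i)"
        using j[OF k, of 0] by (simp add: algebra_simps)
      then have "j k = j z + int m * i"
        using \<open>n > 0\<close> by (metis mult_left_cancel of_int_eq_iff of_nat_0_less_iff less_irrefl)
      then show ?thesis by simp
    qed
    \<comment> \<open>A modulus exceeding the absolute value of the difference divides it, so the
      difference is zero.\<close>
    have "int (nat \<bar>j z - j k\<bar> + 1) dvd j z - j k" by (rule dvd) simp
    then have "j z - j k = 0" using dvd_imp_le_int[of "j z - j k"] by fastforce
    then show ?thesis by simp
  qed

  \<comment> \<open>The common value of \<open>j\<close> shifts \<open>G\<close> by a multiple of
    \<open>n\<close>, which gives another lift of \<open>f\<^sub>n\<close>; now
    \<open>g k x = F0 (x + k n) - k n\<close>.\<close>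
  define F0 where "F0 x = G x + real n * of_int (j z)" for x
  define F where "F = (\<lambda>(x, k). (F0 (x + of_int (k n)) - of_int (k n), k :: nat \<Rightarrow> int))"
  have "homeomorphic_map euclideanreal euclideanreal F0"
  proof -
    have "homeomorphic_maps euclideanreal euclideanreal
        (\<lambda>x. x + real n * of_int (j z)) (\<lambda>x. x - real n * of_int (j z))"
      unfolding homeomorphic_maps_def continuous_map_iff_continuous2
      by (intro conjI continuous_intros ballI) simp_all
    then have "homeomorphic_map euclideanreal euclideanreal (\<lambda>x. x + real n * of_int (j z))"
      by (rule homeomorphic_maps_imp_map)
    from homeomorphic_map_compose[OF G_homeo this] show ?thesis
      by (simp add: F0_def[abs_def] comp_def)
  qed
  moreover have "circle_class n (F0 x) = f\<^sub>n (circle_class n x)" for x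
    unfolding F0_def G_class[symmetric] circle_class_eq_iff by (intro exI[of _ "- j z"]) simp
  ultimately have F0: "circle_lift n f\<^sub>n F0" "homeomorphic_map euclideanreal euclideanreal F0"
    unfolding circle_lift_def by auto
  have "cover_proj (F (x, k)) = f (cover_proj (x, k))" if "k \<in> topspace Zhat" for x k
    using g[OF that] j[OF that] j_const[OF that] by (simp add: F_def F0_def)
  then have "solenoid_lift f F"
    unfolding solenoid_lift_def
    using homeomorphic_map_cover_shear[OF \<open>n > 0\<close> F0(2)] by (auto simp: F_def)
  then show "\<exists>F F0. solenoid_lift f F \<and> circle_lift n f\<^sub>n F0 \<and>
       (\<forall>x. \<forall>k\<in>topspace Zhat.
          F (x, k) = (F0 (x + real_of_int (k n)) - real_of_int (k n), k))"
    using F0(1) by (intro exI[of _ F] exI[of _ F0]) (simp add: F_def)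
next
  assume "\<exists>F F0. solenoid_lift f F \<and> circle_lift n f\<^sub>n F0 \<and>
       (\<forall>x. \<forall>k\<in>topspace Zhat.
          F (x, k) = (F0 (x + real_of_int (k n)) - real_of_int (k n), k))"
  then obtain F F0 where lift: "solenoid_lift f F" "circle_lift n f\<^sub>n F0" and
    F: "\<And>x k. k \<in> topspace Zhat \<Longrightarrow> F (x, k) = (F0 (x + of_int (k n)) - of_int (k n), k)"
    by blast
  \<comment> \<open>Write \<open>z\<close> as a projected point; in coordinate \<open>n\<close> the
    subtracted residue cancels the one added by \<open>cover_proj\<close>.\<close>
  have "f z n = f\<^sub>n (z n)" if z_in: "z \<in> topspace solenoid" for z
  proof -
    obtain x k where k: "k \<in> topspace Zhat" and z: "z = cover_proj (x, k)"
      using cover_proj_surj[OF z_in] by blast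
    have "f z = cover_proj (F (x, k))"
      using lift(1) k unfolding solenoid_lift_def z by simp
    then have "f z n = circle_class n (F0 (x + of_int (k n)))"
      using F[OF k] \<open>n > 0\<close> by (simp add: cover_proj_def)
    also have "\<dots> = f\<^sub>n (z n)"
      using lift(2) \<open>n > 0\<close> unfolding circle_lift_def z by (simp add: cover_proj_def)
    finally show ?thesis .
  qed
  then have "induced_by n f f\<^sub>n" using assms unfolding induced_by_def by blast
  then show "f \<in> Homeo_induced n \<and> induced_by n f f\<^sub>n" unfolding Homeo_induced_def by blast
qed

end
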